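(* Let $n\ge 1$, let $\underline{x},\underline{y}\in\mathbb{R}^{n}$ and $p\in\mathbb{R}$, and let $\underline{N},\underline{M}$ be independent random vectors in $\mathbb{R}^n$, each distributed as $\mathcal{N}(\underline{0},I_{n})$. Define the real numbers $$x=\frac{|\underline{x}+\underline{y}|+|\underline{x}-\underline{y}|}{2},\qquad y=\frac{|\underline{x}+\underline{y}|-|\underline{x}-\underline{y}|}{2}.$$ Then $$\left(\underline{x}+\sqrt{p}\,\underline{N}\right)^{t}\left(\underline{y}+\sqrt{p}\,\underline{M}\right)\;\sim\;\left(x+\sqrt{p}\,N_{1}\right)\left(y+\sqrt{p}\,M_{1}\right)+p\,Z_{n-1}N,$$ where, on the right-hand side, $N$, $N_{1}$, $M_{1}$ are independent standard Gaussian random variables and $Z_{n-1}$ is a random variable, independent of $(N,N_{1},M_{1})$, that is chi-distributed with $n-1$ degrees of freedom.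
   Context: $\sim$ denotes equality in distribution. $|\cdot|$ is the Euclidean norm on $\mathbb{R}^n$, and $\underline{u}^{t}\underline{v}=\sum_{i=1}^n u_i v_i$ (bilinear, with no complex conjugation, also for vectors with complex entries). $\mathcal{N}(\underline{0},I_n)$ is the centered Gaussian law on $\mathbb{R}^n$ with identity covariance. $\sqrt{p}$ is a fixed square root of $p$; if $p<0$ it is a purely imaginary complex number, and the random variables are then complex-valued. The chi distribution with $k$ degrees of freedom is the law of $\left(\sum_{i=1}^{k}G_i^2\right)^{1/2}$ with $G_1,\dots,G_k$ i.i.d. standard Gaussian (for $k=0$ it is the point mass at $0$). *)

theory Defs
  imports "HOL-Probability.Probability"
begin

definition gaussian_vec_density :: "real ^ 'n \<Rightarrow> real" where
  "gaussian_vec_density v = exp (- (norm v)\<^sup>2 / 2) / sqrt ((2 * pi) ^ CARD('n))"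

text \<open>For \<open>k = 0\<close> the product measure is the unit mass on the empty tuple, so the law below
  is the unit mass at \<open>0\<close>.\<close>

definition chi_distribution :: "nat \<Rightarrow> real measure" where
  "chi_distribution k =
     distr (Pi\<^sub>M {..<k} (\<lambda>_. density lborel (\<lambda>t. ennreal (std_normal_density t)))) borel
       (\<lambda>g. sqrt (\<Sum>i<k. (g i)\<^sup>2))"

definition complex_vec :: "real ^ 'n \<Rightarrow> complex ^ 'n" where
  "complex_vec v = (\<chi> i. complex_of_real (v $ i))"

text \<open>Bilinear, without complex conjugation; the library inner product on \<open>complex ^ 'n\<close>
  is the real-valued one and is different.\<close>

definition bilinear_dot :: "complex ^ 'n \<Rightarrow> complex ^ 'n \<Rightarrow> complex" where
  "bilinear_dot u v = (\<Sum>i\<in>UNIV. u $ i * v $ i)"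

text \<open>The library predicate \<open>indep_var\<close> requires both random variables to have the same value
  type.  The following is independence of the generated sigma-algebras, for arbitrary value types.\<close>

definition indep_rv ::
  "'a measure \<Rightarrow> 'b measure \<Rightarrow> ('a \<Rightarrow> 'b) \<Rightarrow> 'c measure \<Rightarrow> ('a \<Rightarrow> 'c) \<Rightarrow> bool" where
  "indep_rv P S X T Y \<longleftrightarrow>
     X \<in> measurable P S \<and> Y \<in> measurable P T \<and>
     prob_space.indep_set P (sets (vimage_algebra (space P) X S))
       (sets (vimage_algebra (space P) Y T))"

end

theory Submission
  imports Defs
begin

text \<open>Let \<open>e\<close> be a basis vector.  The bilinear form is an affine function of \<open>(xv \<bullet> M + yv \<bullet> N, N \<bullet> M)\<close>, so
  it suffices to identify the law of this pair.  Since \<open>N \<bullet> M\<close> is a difference of the squared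
  norms of the independent Gaussian vectors \<open>N + M\<close> and \<open>M - N\<close> (up to a factor), rotating
  each of these separately replaces \<open>xv + yv\<close> and \<open>xv - yv\<close> by multiples of \<open>e\<close>,
  that is, \<open>xv\<close> and \<open>yv\<close> by \<open>x e\<close> and \<open>y e\<close>.  Conditionally on
  \<open>N\<close>, the part of \<open>N \<bullet> M\<close> orthogonal to \<open>e\<close> is a centred Gaussian
  variable, independent of \<open>M \<bullet> e\<close>, whose standard deviation is the norm of the part of
  \<open>N\<close> orthogonal to \<open>e\<close>; that norm is chi-distributed and independent of
  \<open>N \<bullet> e\<close>.\<close>

section \<open>Invariance of Lebesgue measure under orthogonal maps\<close>

lemma nn_integral_lborel_translate:
  fixes f :: "'a::euclidean_space \<Rightarrow> ennreal"
  assumes [measurable]: "f \<in> borel_measurable borel"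
  shows "(\<integral>\<^sup>+x. f (x + a) \<partial>lborel) = (\<integral>\<^sup>+x. f x \<partial>lborel)"
proof -
  have "(\<integral>\<^sup>+x. f x \<partial>lborel) = (\<integral>\<^sup>+x. f x \<partial>distr lborel borel ((+) a))"
    by (simp add: lborel_distr_plus)
  also have "\<dots> = (\<integral>\<^sup>+x. f (x + a) \<partial>lborel)"
    by (subst nn_integral_distr) (simp_all add: add.commute)
  finally show ?thesis ..
qed

lemma nn_integral_lborel_uminus:
  fixes f :: "'a::euclidean_space \<Rightarrow> ennreal"
  assumes [measurable]: "f \<in> borel_measurable borel"
  shows "(\<integral>\<^sup>+x. f (- x) \<partial>lborel) = (\<integral>\<^sup>+x. f x \<partial>lborel)"
proof -
  have "(\<integral>\<^sup>+x. f x \<partial>lborel) = (\<integral>\<^sup>+x. f x \<partial>distr lborel borel (\<lambda>x. 0 + (-1) *\<^sub>R x))"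
    using lborel_affine[of "-1" "0::'a"] by (simp add: density_1)
  also have "\<dots> = (\<integral>\<^sup>+x. f (- x) \<partial>lborel)"
    by (subst nn_integral_distr) simp_all
  finally show ?thesis ..
qed

text \<open>Uniqueness of Haar measure specialised to \<open>distr lborel borel T\<close>: two translations under
  the double integral exchange the roles of \<open>f\<close> and \<open>f \<circ> T\<close>, and the unit
  ball, which \<open>T\<close> preserves, fixes the constant.\<close>

lemma lborel_distr_orthogonal:
  fixes T :: "'a::euclidean_space \<Rightarrow> 'a"
  assumes T: "orthogonal_transformation T"
  shows "distr lborel borel T = lborel"
proof (rule measure_eqI)
  have lin: "linear T" using T by (rule orthogonal_transformation_linear)
  have [measurable]: "T \<in> borel_measurable borel"
    using lin by (intro borel_measurable_continuous_onI linear_continuous_on) (simp add: linear_conv_bounded_linear)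
  have "surj T" using T by (rule orthogonal_transformation_surj)
  fix A :: "'a set" assume "A \<in> sets (distr lborel borel T)"
  then have [measurable]: "A \<in> sets borel" by simp
  let ?f = "indicator (ball 0 1) :: 'a \<Rightarrow> ennreal" and ?g = "indicator A :: 'a \<Rightarrow> ennreal"
  let ?c = "emeasure lborel (ball (0::'a) 1)"
  have [measurable, simp]: "ball (0::'a) 1 \<in> sets borel" by (simp add: borel_open)
  have fT: "?f (T x) = ?f x" for x
    using orthogonal_transformation_norm[OF T, of x] by (simp add: indicator_def)
  have "?c * emeasure lborel A = (\<integral>\<^sup>+x. ?f x * (\<integral>\<^sup>+y. ?g y \<partial>lborel) \<partial>lborel)"
    by (subst nn_integral_multc) simp_all
  also have "\<dots> = (\<integral>\<^sup>+x. ?f (T x) * (\<integral>\<^sup>+y. ?g (y + T x) \<partial>lborel) \<partial>lborel)"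
    by (simp add: fT nn_integral_lborel_translate)
  also have "\<dots> = (\<integral>\<^sup>+x. \<integral>\<^sup>+y. ?f (T x) * ?g (y + T x) \<partial>lborel \<partial>lborel)"
    by (simp add: nn_integral_cmult)
  also have "\<dots> = (\<integral>\<^sup>+y. \<integral>\<^sup>+x. ?f (T x) * ?g (y + T x) \<partial>lborel \<partial>lborel)"
    by (rule lborel_pair.Fubini') measurable
  also have "\<dots> = (\<integral>\<^sup>+y. \<integral>\<^sup>+x. ?f (T x - y) * ?g (T x) \<partial>lborel \<partial>lborel)"
  proof (rule nn_integral_cong)
    fix y
    \<comment> \<open>Surjectivity pulls the shift by \<open>y\<close> in the target back to a shift
      by \<open>z\<close> in the source, where translation invariance applies:
      \<open>T (x + z) = T x + y\<close>.\<close>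
    obtain z where z: "T z = y" using \<open>surj T\<close> by (metis surjD)
    have "(\<integral>\<^sup>+x. ?f (T (x + z) - y) * ?g (T (x + z)) \<partial>lborel) = (\<integral>\<^sup>+x. ?f (T x - y) * ?g (T x) \<partial>lborel)"
      by (rule nn_integral_lborel_translate) measurable
    then show "(\<integral>\<^sup>+x. ?f (T x) * ?g (y + T x) \<partial>lborel) = (\<integral>\<^sup>+x. ?f (T x - y) * ?g (T x) \<partial>lborel)"
      by (simp add: linear_add[OF lin] z add.commute)
  qed
  also have "\<dots> = (\<integral>\<^sup>+x. \<integral>\<^sup>+y. ?f (T x - y) * ?g (T x) \<partial>lborel \<partial>lborel)"
    by (rule lborel_pair.Fubini') measurable
  also have "\<dots> = (\<integral>\<^sup>+x. ?c * ?g (T x) \<partial>lborel)"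
  proof (rule nn_integral_cong)
    fix x
    \<comment> \<open>The integrand is the indicator of the unit ball centred at \<open>T x\<close>;
      reflection and translation move it to the origin, so the inner integral no longer depends on
      \<open>x\<close>.\<close>
    have "(\<integral>\<^sup>+y. ?f (T x - y) \<partial>lborel) = (\<integral>\<^sup>+y. ?f (T x + y) \<partial>lborel)"
      using nn_integral_lborel_uminus[of "\<lambda>y. ?f (T x + y)"] by simp
    also have "\<dots> = ?c"
      using nn_integral_lborel_translate[of ?f "T x"] by (simp add: add.commute)
    finally show "(\<integral>\<^sup>+y. ?f (T x - y) * ?g (T x) \<partial>lborel) = ?c * ?g (T x)"
      by (simp add: nn_integral_multc)
  qed
  also have "\<dots> = ?c * (\<integral>\<^sup>+x. ?g (T x) \<partial>lborel)"
    by (rule nn_integral_cmult) measurable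
  also have "(\<integral>\<^sup>+x. ?g (T x) \<partial>lborel) = (\<integral>\<^sup>+x. ?g x \<partial>distr lborel borel T)"
    by (rule nn_integral_distr[symmetric]) simp_all
  also have "\<dots> = emeasure (distr lborel borel T) A"
    by simp
  finally have eq: "?c * emeasure lborel A = ?c * emeasure (distr lborel borel T) A" .
  \<comment> \<open>Cancelling \<open>?c\<close> from \<open>eq\<close> in the extended reals
    requires it to be neither zero nor infinite.\<close>
  have "unit_ball_vol (DIM('a)) \<noteq> 0"
    by (metis less_irrefl of_nat_0_le_iff unit_ball_vol_pos)
  then have "?c \<noteq> 0"
    by (simp add: emeasure_ball)
  moreover have "?c \<noteq> \<infinity>"
    using emeasure_lborel_ball_finite[of "0::'a" 1] by simp
  ultimately show "emeasure (distr lborel borel T) A = emeasure lborel A"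
    using eq by (simp add: ennreal_mult_cancel_left)
qed simp

section \<open>The standard Gaussian measure and its independent coordinates\<close>

definition std_gaussian :: "'a::euclidean_space measure" where
  "std_gaussian = density lborel (\<lambda>v. ennreal (exp (- (norm v)\<^sup>2 / 2) / sqrt ((2 * pi) ^ DIM('a))))"

lemma prod_std_normal_density:
  fixes v :: "'a::euclidean_space"
  shows "(\<Prod>b\<in>Basis. std_normal_density (v \<bullet> b)) = exp (- (norm v)\<^sup>2 / 2) / sqrt ((2 * pi) ^ DIM('a))"
proof -
  have "(norm v)\<^sup>2 = (\<Sum>b\<in>Basis. (v \<bullet> b)\<^sup>2)"
    unfolding power2_norm_eq_inner by (subst euclidean_inner) (simp add: power2_eq_square)
  then show ?thesis
    by (simp add: std_normal_density_def prod_dividef real_sqrt_power exp_sum[symmetric]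
       sum_divide_distrib sum_negf
       power_mult_distrib real_sqrt_mult)
qed

text \<open>A product measure is determined by its values on boxes. There both the density and the
  indicator factor over the coordinates, so the integral is a product of one-dimensional
  ones.\<close>

lemma PiM_density:
  fixes f :: "'i \<Rightarrow> 'a \<Rightarrow> ennreal"
  assumes I: "finite I" and M: "product_sigma_finite M" "product_sigma_finite (\<lambda>i. density (M i) (f i))"
    and f: "\<And>i. i \<in> I \<Longrightarrow> f i \<in> borel_measurable (M i)"
  shows "density (PiM I M) (\<lambda>x. \<Prod>i\<in>I. f i (x i)) = PiM I (\<lambda>i. density (M i) (f i))"
proof (rule product_sigma_finite.PiM_eqI[OF M(2) I])
  interpret product_sigma_finite M by fact
  note f[measurable]
  fix A assume "\<And>i. i \<in> I \<Longrightarrow> A i \<in> sets (density (M i) (f i))"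
  then have A[measurable]: "\<And>i. i \<in> I \<Longrightarrow> A i \<in> sets (M i)" by simp
  have [measurable]: "Pi\<^sub>E I A \<in> sets (PiM I M)" using I A by (intro sets_PiM_I_finite) auto
  have [measurable]: "(\<lambda>x. \<Prod>i\<in>I. f i (x i)) \<in> borel_measurable (PiM I M)" by measurable
  have "emeasure (density (PiM I M) (\<lambda>x. \<Prod>i\<in>I. f i (x i))) (Pi\<^sub>E I A)
    = (\<integral>\<^sup>+x. (\<Prod>i\<in>I. f i (x i)) * indicator (Pi\<^sub>E I A) x \<partial>PiM I M)"
    by (rule emeasure_density) measurable
  also have "\<dots> = (\<integral>\<^sup>+x. (\<Prod>i\<in>I. f i (x i) * indicator (A i) (x i)) \<partial>PiM I M)"
    using I by (intro nn_integral_cong)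
      (auto simp: prod.distrib indicator_def space_PiM PiE_iff prod_zero_iff)
  also have "\<dots> = (\<Prod>i\<in>I. \<integral>\<^sup>+x. f i x * indicator (A i) x \<partial>M i)"
    using I by (intro product_nn_integral_prod) measurable
  finally show "emeasure (density (PiM I M) (\<lambda>x. \<Prod>i\<in>I. f i (x i))) (Pi\<^sub>E I A)
    = (\<Prod>i\<in>I. emeasure (density (M i) (f i)) (A i))"
    using A f by (simp add: emeasure_density)
qed (simp cong: sets_PiM_cong)

lemma prob_space_std_normal: "prob_space std_normal_distribution"
  by (rule prob_space_normal_density) simp

text \<open>Lebesgue measure is the image of the product of one-dimensional Lebesgue measures under
  \<open>?S\<close>. A density passes through such an image, and this one factors over the
  coordinates.\<close>

lemma std_gaussian_eq_PiM:
  "(std_gaussian :: 'a::euclidean_space measure) =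
     distr (PiM Basis (\<lambda>_. std_normal_distribution)) borel (\<lambda>g. \<Sum>b\<in>Basis. g b *\<^sub>R b)"
proof -
  interpret N: prob_space std_normal_distribution by (rule prob_space_std_normal)
  let ?S = "\<lambda>g. \<Sum>b\<in>Basis. g b *\<^sub>R (b::'a)"
  let ?d = "\<lambda>v::'a. ennreal (exp (- (norm v)\<^sup>2 / 2) / sqrt ((2 * pi) ^ DIM('a)))"
  have "density (distr (PiM Basis (\<lambda>_. lborel)) borel ?S) ?d
    = distr (density (PiM Basis (\<lambda>_. lborel)) (\<lambda>g. ?d (?S g))) borel ?S"
    by (rule density_distr) measurable
  also have "(\<lambda>g. ?d (?S g)) = (\<lambda>g. \<Prod>b\<in>Basis. ennreal (std_normal_density (g b)))"
    unfolding prod_std_normal_density[symmetric] by (simp add: prod_ennreal)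
  also have "density (PiM Basis (\<lambda>_. lborel)) (\<lambda>g. \<Prod>b\<in>(Basis::'a set). ennreal (std_normal_density (g b)))
     = PiM Basis (\<lambda>_. std_normal_distribution)"
    by (rule PiM_density) (auto simp: product_sigma_finite_def sigma_finite_lborel N.sigma_finite_measure_axioms)
  finally show ?thesis by (simp add: std_gaussian_def lborel_eq[symmetric])
qed

lemma sets_std_gaussian[simp, measurable_cong]: "sets std_gaussian = sets borel"
  by (simp add: std_gaussian_def)

lemma space_std_gaussian[simp]: "space std_gaussian = UNIV"
  by (simp add: std_gaussian_def)

lemma prob_space_std_gaussian: "prob_space (std_gaussian :: 'a::euclidean_space measure)"
  unfolding std_gaussian_eq_PiM
  by (intro prob_space.prob_space_distr prob_space_PiM prob_space_std_normal) measurable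

text \<open>Taking coordinates inverts the map that assembles a vector from its coordinates, so any
  law depending only on coordinates can be computed on the product measure.\<close>

lemma distr_std_gaussian_coordinates:
  fixes h :: "('a::euclidean_space \<Rightarrow> real) \<Rightarrow> 'b"
  assumes h[measurable]: "h \<in> PiM Basis (\<lambda>_. borel) \<rightarrow>\<^sub>M S"
  shows "distr std_gaussian S (\<lambda>v. h (\<lambda>b\<in>Basis. v \<bullet> b)) = distr (PiM Basis (\<lambda>_. std_normal_distribution)) S h"
proof -
  have [measurable]: "(\<lambda>v::'a. h (\<lambda>b\<in>Basis. v \<bullet> b)) \<in> borel \<rightarrow>\<^sub>M S"
    by measurable
  have "distr std_gaussian S (\<lambda>v. h (\<lambda>b\<in>Basis. v \<bullet> b)) =
     distr (PiM Basis (\<lambda>_. std_normal_distribution)) S (\<lambda>g. h (\<lambda>b\<in>Basis. (\<Sum>b\<in>Basis. g b *\<^sub>R b) \<bullet> b))"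
    unfolding std_gaussian_eq_PiM by (subst distr_distr) (auto simp: comp_def)
  also have "\<dots> = distr (PiM Basis (\<lambda>_. std_normal_distribution)) S h"
    \<comment> \<open>Points of the product space are extensional, hence restricting to
      \<open>Basis\<close> returns the same function.\<close>
    by (intro distr_cong refl arg_cong[where f=h])
      (auto simp: space_PiM PiE_iff extensional_def fun_eq_iff)
  finally show ?thesis .
qed

lemma distr_std_gaussian_coordinate:
  fixes b :: "'a::euclidean_space"
  assumes b: "b \<in> Basis"
  shows "distr std_gaussian borel (\<lambda>v. v \<bullet> b) = std_normal_distribution"
proof -
  have "distr std_gaussian borel (\<lambda>v. v \<bullet> b) = distr std_gaussian borel (\<lambda>v. (\<lambda>g. g b) (\<lambda>b\<in>Basis. v \<bullet> b))"
    using b by simp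
  also have "\<dots> = distr (PiM Basis (\<lambda>_. std_normal_distribution)) borel (\<lambda>g. g b)"
    using b by (intro distr_std_gaussian_coordinates) measurable
  also have "\<dots> = distr (PiM Basis (\<lambda>_. std_normal_distribution)) std_normal_distribution (\<lambda>g. g b)"
    by (rule distr_cong) auto
  also have "\<dots> = std_normal_distribution"
    using b by (intro distr_PiM_component prob_space_std_normal)
  finally show ?thesis .
qed

text \<open>Independence means that the joint law of the coordinates is the product of their laws;
  this is the transfer to the product measure applied to the identity.\<close>

lemma indep_vars_std_gaussian:
  "prob_space.indep_vars std_gaussian (\<lambda>_. borel) (\<lambda>b v. v \<bullet> b) (Basis :: 'a::euclidean_space set)"
proof -
  interpret prob_space "std_gaussian :: 'a measure" by (rule prob_space_std_gaussian)
  have "distr std_gaussian (PiM Basis (\<lambda>_. borel)) (\<lambda>v. \<lambda>b\<in>Basis. v \<bullet> (b::'a))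
      = distr (PiM Basis (\<lambda>_. std_normal_distribution)) (PiM Basis (\<lambda>_. borel)) (\<lambda>g. g)"
    by (rule distr_std_gaussian_coordinates) measurable
  also have "\<dots> = distr (PiM Basis (\<lambda>_. std_normal_distribution)) (PiM Basis (\<lambda>_. std_normal_distribution)) (\<lambda>g. g)"
    by (intro distr_cong sets_PiM_cong) simp_all
  also have "\<dots> = PiM Basis (\<lambda>b. distr std_gaussian borel (\<lambda>v. v \<bullet> (b::'a)))"
    by (simp add: distr_id2 distr_std_gaussian_coordinate cong: PiM_cong)
  finally show ?thesis
    by (subst indep_vars_iff_distr_eq_PiM) simp_all
qed

section \<open>Rotation invariance of a pair of Gaussian vectors\<close>

text \<open>The norm of a pair satisfies Pythagoras, so the product of the two densities is a
  function of that norm alone. This radial form gives invariance under orthogonal maps that mix the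
  two vectors.\<close>

lemma pair_std_gaussian_eq_density:
  "(std_gaussian :: 'a::euclidean_space measure) \<Otimes>\<^sub>M (std_gaussian :: 'a measure) =
     density lborel (\<lambda>v. ennreal (exp (- (norm v)\<^sup>2 / 2) / (2 * pi) ^ DIM('a)))"
proof -
  interpret prob_space "std_gaussian :: 'a measure" by (rule prob_space_std_gaussian)
  let ?d = "\<lambda>v::'a. ennreal (exp (- (norm v)\<^sup>2 / 2) / sqrt ((2 * pi) ^ DIM('a)))"
  have "(std_gaussian :: 'a measure) \<Otimes>\<^sub>M (std_gaussian :: 'a measure) =
      density (lborel \<Otimes>\<^sub>M lborel) (\<lambda>(v, w). ?d v * ?d w)"
    unfolding std_gaussian_def
    by (rule pair_measure_density)
      (use sigma_finite_measure_axioms in \<open>simp_all add: std_gaussian_def sigma_finite_lborel\<close>)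
  also have "\<dots> = density lborel (\<lambda>v. ennreal (exp (- (norm v)\<^sup>2 / 2) / (2 * pi) ^ DIM('a)))"
    unfolding lborel_prod
  proof (rule density_cong)
    have "(\<lambda>(v, w). ?d v * ?d w) \<in> borel_measurable (borel \<Otimes>\<^sub>M borel)" by measurable
    then show "(\<lambda>(v, w). ?d v * ?d w) \<in> borel_measurable lborel" by (simp add: borel_prod)
  qed (auto simp: norm_Pair ennreal_mult[symmetric] exp_add[symmetric] add_divide_distrib)
  finally show ?thesis .
qed

lemma distr_pair_std_gaussian_orthogonal:
  fixes T :: "'a::euclidean_space \<times> 'a \<Rightarrow> 'a \<times> 'a"
  assumes T: "orthogonal_transformation T"
  shows "distr (std_gaussian \<Otimes>\<^sub>M std_gaussian) borel T = std_gaussian \<Otimes>\<^sub>M std_gaussian"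
proof -
  have [measurable]: "T \<in> borel_measurable borel"
    using orthogonal_transformation_linear[OF T]
    by (intro borel_measurable_continuous_onI linear_continuous_on) (simp add: linear_conv_bounded_linear)
  let ?d = "\<lambda>v::'a \<times> 'a. ennreal (exp (- (norm v)\<^sup>2 / 2) / (2 * pi) ^ DIM('a))"
  have "distr (density lborel (\<lambda>v. ?d (T v))) borel T = density (distr lborel borel T) ?d"
    by (rule density_distr[symmetric]) measurable
  then show ?thesis
    by (simp add: pair_std_gaussian_eq_density lborel_distr_orthogonal[OF T]
        orthogonal_transformation_norm[OF T])
qed

text \<open>In the coordinates \<open>v + w\<close> and \<open>w - v\<close> the form \<open>v \<bullet> w\<close> is
  a difference of squared norms, so it is invariant under independent rotations \<open>A\<close> and
  \<open>B\<close> of the two coordinates.\<close>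

lemma distr_std_gaussian_inner_rotate:
  fixes a b e :: "real ^ 'n" and x y :: real
  assumes e: "norm e = 1"
    and x: "x = (norm (a + b) + norm (a - b)) / 2"
    and y: "y = (norm (a + b) - norm (a - b)) / 2"
  shows "distr (std_gaussian \<Otimes>\<^sub>M std_gaussian) borel (\<lambda>(v, w). (a \<bullet> w + b \<bullet> v, v \<bullet> w)) =
    distr (std_gaussian \<Otimes>\<^sub>M std_gaussian) borel
      (\<lambda>(v, w). (x * (w \<bullet> e) + y * (v \<bullet> e), v \<bullet> w))"
proof -
  have sum: "x + y = norm (a + b)" and diff: "x - y = norm (a - b)"
    by (simp_all add: x y field_simps)
  \<comment> \<open>Both vectors have the same norm, since \<open>x + y = norm (a + b)\<close> is
    nonnegative and \<open>e\<close> is a unit vector. The same holds for \<open>B\<close> with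
    \<open>x - y = norm (a - b)\<close>.\<close>
  obtain A where A: "orthogonal_transformation A" "A ((x + y) *\<^sub>R e) = a + b"
    using orthogonal_transformation_exists[of "(x + y) *\<^sub>R e" "a + b"] by (auto simp: e sum)
  obtain B where B: "orthogonal_transformation B" "B ((x - y) *\<^sub>R e) = a - b"
    using orthogonal_transformation_exists[of "(x - y) *\<^sub>R e" "a - b"] by (auto simp: e diff)
  note lin = orthogonal_transformation_linear[OF A(1)] orthogonal_transformation_linear[OF B(1)]
  have innerA: "A v \<bullet> A w = v \<bullet> w" and innerB: "B v \<bullet> B w = v \<bullet> w" for v w
    using A(1) B(1) by (auto simp: orthogonal_transformation_def)
  \<comment> \<open>\<open>T\<close> applies \<open>A\<close> to the sum and \<open>B\<close> to the
    difference of the two components, then returns to the original coordinates; it is the identity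
    if \<open>A\<close> and \<open>B\<close> are.\<close>
  define T where "T p = ((1/2) *\<^sub>R (A (fst p + snd p) - B (snd p - fst p)),
      (1/2) *\<^sub>R (A (fst p + snd p) + B (snd p - fst p)))" for p
  have "linear T"
    unfolding T_def
    by (intro linearI)
      (auto simp: linear_add[OF lin(1)] linear_add[OF lin(2)] linear_diff[OF lin(1)]
        linear_diff[OF lin(2)] linear_cmul[OF lin(1)] linear_cmul[OF lin(2)] algebra_simps)
  moreover have "T p \<bullet> T q = p \<bullet> q" for p q
  proof -
    \<comment> \<open>The mixed terms between \<open>A\<close> and \<open>B\<close> have opposite
      signs in the two components and cancel.\<close>
    have "T p \<bullet> T q = (A (fst p + snd p) \<bullet> A (fst q + snd q) + B (snd p - fst p) \<bullet> B (snd q - fst q)) / 2"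
      by (simp add: T_def inner_prod_def inner_simps field_simps)
    also have "\<dots> = p \<bullet> q"
      unfolding innerA innerB by (simp add: inner_prod_def inner_simps field_simps)
    finally show ?thesis .
  qed
  ultimately have T: "orthogonal_transformation T"
    by (simp add: orthogonal_transformation_def)
  have [measurable]: "T \<in> borel_measurable borel"
    using \<open>linear T\<close>
    by (intro borel_measurable_continuous_onI linear_continuous_on) (simp add: linear_conv_bounded_linear)
  have dot: "fst (T p) \<bullet> snd (T p) = fst p \<bullet> snd p" for p
  proof -
    have "fst (T p) \<bullet> snd (T p) = (A (fst p + snd p) \<bullet> A (fst p + snd p) - B (snd p - fst p) \<bullet> B (snd p - fst p)) / 4"
      by (simp add: T_def inner_simps field_simps inner_commute)
    also have "\<dots> = fst p \<bullet> snd p"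
      unfolding innerA innerB by (simp add: inner_simps field_simps inner_commute)
    finally show ?thesis .
  qed
  have lin_form: "a \<bullet> snd (T p) + b \<bullet> fst (T p) = x * (snd p \<bullet> e) + y * (fst p \<bullet> e)" for p
  proof -
    have "a \<bullet> snd (T p) + b \<bullet> fst (T p) = ((a + b) \<bullet> A (fst p + snd p) + (a - b) \<bullet> B (snd p - fst p)) / 2"
      by (simp add: T_def inner_simps field_simps)
    \<comment> \<open>Writing \<open>a + b\<close> and \<open>a - b\<close> as images under
      \<open>A\<close> and \<open>B\<close> lets the rotations drop out of the inner
      products.\<close>
    also have "\<dots> = (((x + y) *\<^sub>R e) \<bullet> (fst p + snd p) + ((x - y) *\<^sub>R e) \<bullet> (snd p - fst p)) / 2"
      unfolding A(2)[symmetric] B(2)[symmetric] innerA innerB ..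
    also have "\<dots> = x * (snd p \<bullet> e) + y * (fst p \<bullet> e)"
      by (simp add: inner_simps field_simps inner_commute)
    finally show ?thesis .
  qed
  have "distr (std_gaussian \<Otimes>\<^sub>M std_gaussian) borel (\<lambda>(v, w). (a \<bullet> w + b \<bullet> v, v \<bullet> w)) =
     distr (distr (std_gaussian \<Otimes>\<^sub>M std_gaussian) borel T) borel (\<lambda>(v, w). (a \<bullet> w + b \<bullet> v, v \<bullet> w))"
    by (simp only: distr_pair_std_gaussian_orthogonal[OF T])
  also have "\<dots> = distr (std_gaussian \<Otimes>\<^sub>M std_gaussian) borel
      ((\<lambda>(v, w). (a \<bullet> w + b \<bullet> v, v \<bullet> w)) \<circ> T)"
  proof (rule distr_distr)
    show "(\<lambda>(v, w). (a \<bullet> w + b \<bullet> v, v \<bullet> w)) \<in> borel_measurable borel"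
      by (simp add: borel_prod[symmetric])
  qed (simp add: pair_std_gaussian_eq_density)
  also have "(\<lambda>(v, w). (a \<bullet> w + b \<bullet> v, v \<bullet> w)) \<circ> T =
      (\<lambda>(v, w). (x * (w \<bullet> e) + y * (v \<bullet> e), v \<bullet> w))"
    using dot lin_form by (simp add: fun_eq_iff case_prod_beta)
  finally show ?thesis .
qed

section \<open>Laws of linear forms and norms in independent coordinates\<close>

text \<open>Disjoint blocks of an independent family are independent, and applying \<open>f\<close>
  and \<open>g\<close> maps the product of the block laws to a product. The targets \<open>S\<close>
  and \<open>T\<close> may have different value types.\<close>

lemma (in prob_space) distr_pair_restrict_indep_vars:
  assumes ind: "indep_vars M' X I" "A \<inter> B = {}" "A \<subseteq> I" "B \<subseteq> I"
    and f: "f \<in> PiM A M' \<rightarrow>\<^sub>M S" and g: "g \<in> PiM B M' \<rightarrow>\<^sub>M T"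
  shows "distr M (S \<Otimes>\<^sub>M T) (\<lambda>\<omega>. (f (\<lambda>i\<in>A. X i \<omega>), g (\<lambda>i\<in>B. X i \<omega>))) =
    distr M S (\<lambda>\<omega>. f (\<lambda>i\<in>A. X i \<omega>)) \<Otimes>\<^sub>M distr M T (\<lambda>\<omega>. g (\<lambda>i\<in>B. X i \<omega>))"
proof -
  let ?F = "\<lambda>\<omega>. \<lambda>i\<in>A. X i \<omega>" and ?G = "\<lambda>\<omega>. \<lambda>i\<in>B. X i \<omega>"
  have iv: "indep_var (PiM A M') ?F (PiM B M') ?G"
    by (rule indep_var_restrict[OF ind])
  note [measurable] = indep_var_rv1[OF iv] indep_var_rv2[OF iv] f g
  have "distr M S (\<lambda>\<omega>. f (?F \<omega>)) \<Otimes>\<^sub>M distr M T (\<lambda>\<omega>. g (?G \<omega>)) =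
     distr (distr M (PiM A M') ?F) S f \<Otimes>\<^sub>M distr (distr M (PiM B M') ?G) T g"
    by (simp add: distr_distr comp_def)
  also have "\<dots> = distr (distr M (PiM A M') ?F \<Otimes>\<^sub>M distr M (PiM B M') ?G) (S \<Otimes>\<^sub>M T) (\<lambda>(x, y). (f x, g y))"
  proof (rule pair_measure_distr)
    interpret G: prob_space "distr (distr M (PiM B M') ?G) T g"
      by (intro prob_space.prob_space_distr prob_space_distr) measurable
    show "sigma_finite_measure (distr (distr M (PiM B M') ?G) T g)" ..
  qed measurable
  also have "distr M (PiM A M') ?F \<Otimes>\<^sub>M distr M (PiM B M') ?G =
      distr M (PiM A M' \<Otimes>\<^sub>M PiM B M') (\<lambda>\<omega>. (?F \<omega>, ?G \<omega>))"
    using iv unfolding indep_var_distribution_eq by simp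
  also have "distr (distr M (PiM A M' \<Otimes>\<^sub>M PiM B M') (\<lambda>\<omega>. (?F \<omega>, ?G \<omega>))) (S \<Otimes>\<^sub>M T) (\<lambda>(x, y). (f x, g y)) =
      distr M (S \<Otimes>\<^sub>M T) (\<lambda>\<omega>. (f (?F \<omega>), g (?G \<omega>)))"
    by (subst distr_distr) (simp_all add: comp_def)
  finally show ?thesis by (rule sym)
qed

lemma char_distr_mult:
  assumes [measurable_cong]: "sets M = sets borel"
  shows "char (distr M borel ((*) a)) t = char M (a * t)"
  unfolding char_def by (subst integral_distr) (simp_all add: mult_ac)

text \<open>Characteristic functions of independent summands multiply, so the squared coefficients
  add up in the exponent. Expressing the result as a scaled standard normal also covers the
  degenerate case where all coefficients vanish or \<open>B\<close> is empty.\<close>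

lemma distr_std_gaussian_sum:
  fixes c :: "'a::euclidean_space \<Rightarrow> real"
  assumes B: "B \<subseteq> Basis"
  shows "distr std_gaussian borel (\<lambda>v. \<Sum>b\<in>B. c b * (v \<bullet> b)) =
    distr std_normal_distribution borel ((*) (sqrt (\<Sum>b\<in>B. (c b)\<^sup>2)))"
proof (rule Levy_uniqueness)
  interpret prob_space "std_gaussian :: 'a measure" by (rule prob_space_std_gaussian)
  interpret N: prob_space std_normal_distribution by (rule prob_space_std_normal)
  show "real_distribution (distr (std_gaussian :: 'a measure) borel (\<lambda>v. \<Sum>b\<in>B. c b * (v \<bullet> b)))"
    by (rule real_distribution_distr) measurable
  show "real_distribution (distr std_normal_distribution borel ((*) (sqrt (\<Sum>b\<in>B. (c b)\<^sup>2))))"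
    by (rule N.real_distribution_distr) measurable
  show "char (distr (std_gaussian :: 'a measure) borel (\<lambda>v. \<Sum>b\<in>B. c b * (v \<bullet> b))) =
     char (distr std_normal_distribution borel ((*) (sqrt (\<Sum>b\<in>B. (c b)\<^sup>2))))"
  proof
    fix t
    have ind: "indep_vars (\<lambda>_. borel) (\<lambda>b v. c b * (v \<bullet> b)) B"
      using indep_vars_subset[OF indep_vars_std_gaussian B] 
      by (rule indep_vars_compose2) measurable
    have 1: "char (distr std_gaussian borel (\<lambda>v. c b * (v \<bullet> b))) t = exp (- (c b * t)\<^sup>2 / 2)"
      if "b \<in> B" for b
    proof -
      have "distr std_gaussian borel (\<lambda>v. c b * (v \<bullet> b)) =
          distr (distr std_gaussian borel (\<lambda>v. v \<bullet> b)) borel ((*) (c b))"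
        by (subst distr_distr) (auto simp: comp_def)
      then show ?thesis
        using that B by (simp add: distr_std_gaussian_coordinate subset_eq char_distr_mult char_std_normal_distribution)
    qed
    have "char (distr (std_gaussian :: 'a measure) borel (\<lambda>v. \<Sum>b\<in>B. c b * (v \<bullet> b))) t =
        (\<Prod>b\<in>B. complex_of_real (exp (- (c b * t)\<^sup>2 / 2)))"
      by (simp add: char_distr_sum[OF ind] 1)
    also have "\<dots> = complex_of_real (exp (\<Sum>b\<in>B. - (c b * t)\<^sup>2 / 2))"
      using B by (simp add: exp_sum finite_subset)
    also have "(\<Sum>b\<in>B. - (c b * t)\<^sup>2 / 2) = - (sqrt (\<Sum>b\<in>B. (c b)\<^sup>2) * t)\<^sup>2 / 2"
      by (simp add: power_mult_distrib sum_nonneg sum_negf sum_divide_distrib sum_distrib_right)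
    finally show "char (distr (std_gaussian :: 'a measure) borel (\<lambda>v. \<Sum>b\<in>B. c b * (v \<bullet> b))) t =
       char (distr std_normal_distribution borel ((*) (sqrt (\<Sum>b\<in>B. (c b)\<^sup>2)))) t"
      by (simp add: char_distr_mult char_std_normal_distribution)
  qed
qed

lemma distr_std_gaussian_sum_coordinate:
  fixes e :: "'a::euclidean_space"
  assumes e: "e \<in> Basis"
  shows "distr std_gaussian (borel \<Otimes>\<^sub>M borel) (\<lambda>v. (\<Sum>b\<in>Basis - {e}. c b * (v \<bullet> b), v \<bullet> e)) =
    distr std_normal_distribution borel ((*) (sqrt (\<Sum>b\<in>Basis - {e}. (c b)\<^sup>2))) \<Otimes>\<^sub>M
    std_normal_distribution"
proof -
  interpret prob_space "std_gaussian :: 'a measure" by (rule prob_space_std_gaussian)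
  show ?thesis
    using distr_pair_restrict_indep_vars[OF indep_vars_std_gaussian, of "Basis - {e}" "{e}"
        "\<lambda>g. \<Sum>b\<in>Basis - {e}. c b * g b" borel "\<lambda>g. g e" borel] e
    by (simp add: distr_std_gaussian_sum distr_std_gaussian_coordinate Diff_subset)
qed

text \<open>The chi law is defined with indices below \<open>card B\<close>; a bijection from these
  onto \<open>B\<close> reindexes the product of normal laws, whose factors are all equal.\<close>

lemma chi_distribution_eq_distr_std_gaussian:
  fixes B :: "'a::euclidean_space set"
  assumes B: "B \<subseteq> Basis"
  shows "chi_distribution (card B) = distr std_gaussian borel (\<lambda>v. sqrt (\<Sum>b\<in>B. (v \<bullet> b)\<^sup>2))"
proof -
  let ?PB = "PiM (Basis::'a set) (\<lambda>_. std_normal_distribution)"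
  have "finite B" by (rule finite_subset[OF B finite_Basis])
  then obtain f where f: "bij_betw f {..<card B} B"
    using ex_bij_betw_nat_finite[of B] by (auto simp: atLeast0LessThan)
  have im: "f i \<in> B" if "i < card B" for i using f that by (auto simp: bij_betw_def)
  have "chi_distribution (card B) = 
     distr (distr ?PB (PiM {..<card B} (\<lambda>_. std_normal_distribution)) (\<lambda>\<omega>. \<lambda>n\<in>{..<card B}. \<omega> (f n)))
       borel (\<lambda>g. sqrt (\<Sum>i<card B. (g i)\<^sup>2))"
    unfolding chi_distribution_def
    using f B im
    by (subst distr_PiM_reindex) (auto simp: bij_betw_def prob_space_std_normal)
  also have "\<dots> = distr ?PB borel (\<lambda>g. sqrt (\<Sum>i<card B. (g (f i))\<^sup>2))"
    using im B by (subst distr_distr) (auto simp: comp_def subset_eq intro!: measurable_restrict)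
  also have "\<dots> = distr ?PB borel (\<lambda>g. sqrt (\<Sum>b\<in>B. (g b)\<^sup>2))"
    by (simp add: sum.reindex_bij_betw[OF f, of "\<lambda>b. (_ b)\<^sup>2"])
  also have "\<dots> = distr std_gaussian borel (\<lambda>v. sqrt (\<Sum>b\<in>B. ((\<lambda>b\<in>Basis. v \<bullet> b) b)\<^sup>2))"
    using B by (intro distr_std_gaussian_coordinates[symmetric]) (auto simp: subset_eq)
  also have "\<dots> = distr std_gaussian borel (\<lambda>v. sqrt (\<Sum>b\<in>B. (v \<bullet> b)\<^sup>2))"
    using B by (intro distr_cong refl arg_cong[where f=sqrt] sum.cong) auto
  finally show ?thesis .
qed

lemma prob_space_chi_distribution: "prob_space (chi_distribution k)"
  unfolding chi_distribution_def
  by (intro prob_space.prob_space_distr prob_space_PiM prob_space_std_normal) measurable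

lemma sets_chi_distribution[simp, measurable_cong]: "sets (chi_distribution k) = sets borel"
  by (simp add: chi_distribution_def)

text \<open>The two components use disjoint sets of independent coordinates. In dimension one
  \<open>Basis - {e}\<close> is empty and the chi factor is the point mass at 0.\<close>

lemma distr_std_gaussian_norm_coordinate:
  fixes e :: "'a::euclidean_space"
  assumes e: "e \<in> Basis"
  shows "distr std_gaussian (borel \<Otimes>\<^sub>M borel) (\<lambda>v. (sqrt (\<Sum>b\<in>Basis - {e}. (v \<bullet> b)\<^sup>2), v \<bullet> e)) =
    chi_distribution (DIM('a) - 1) \<Otimes>\<^sub>M std_normal_distribution"
proof -
  interpret prob_space "std_gaussian :: 'a measure" by (rule prob_space_std_gaussian)
  have "card (Basis - {e}) = DIM('a) - 1" using e by simp
  then show ?thesis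
    using distr_pair_restrict_indep_vars[OF indep_vars_std_gaussian, of "Basis - {e}" "{e}"
        "\<lambda>g. sqrt (\<Sum>b\<in>Basis - {e}. (g b)\<^sup>2)" borel "\<lambda>g. g e" borel] e
      chi_distribution_eq_distr_std_gaussian[of "Basis - {e}"]
    by (simp add: distr_std_gaussian_coordinate Diff_subset)
qed

section \<open>Conditioning on the first Gaussian vector\<close>

lemma emeasure_distr_nn_integral:
  assumes f: "f \<in> M \<rightarrow>\<^sub>M N" and A: "A \<in> sets N"
  shows "emeasure (distr M N f) A = (\<integral>\<^sup>+x. indicator A (f x) \<partial>M)"
proof -
  have "emeasure (distr M N f) A = (\<integral>\<^sup>+y. indicator A y \<partial>distr M N f)"
    using A by simp
  also have "\<dots> = (\<integral>\<^sup>+x. indicator A (f x) \<partial>M)"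
    using f by (rule nn_integral_distr) (use A in simp)
  finally show ?thesis .
qed

text \<open>With \<open>v\<close> fixed, \<open>v \<bullet> w\<close> splits into its part along
  \<open>e\<close> and a linear form in the remaining coordinates of \<open>w\<close>. The latter is
  independent of \<open>w \<bullet> e\<close> and distributed as a standard normal \<open>h\<close>
  times the norm of the rest of \<open>v\<close>.\<close>

lemma nn_integral_inner_std_gaussian:
  fixes e v :: "'a::euclidean_space" and F :: "real \<times> real \<Rightarrow> ennreal"
  assumes e: "e \<in> Basis" and F[measurable]: "F \<in> borel_measurable (borel \<Otimes>\<^sub>M borel)"
  shows "(\<integral>\<^sup>+w. F (w \<bullet> e, v \<bullet> w) \<partial>std_gaussian) =
    (\<integral>\<^sup>+h. \<integral>\<^sup>+m. F (m, (v \<bullet> e) * m + sqrt (\<Sum>b\<in>Basis - {e}. (v \<bullet> b)\<^sup>2) * h)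
      \<partial>std_normal_distribution \<partial>std_normal_distribution)"
proof -
  interpret N: prob_space std_normal_distribution by (rule prob_space_std_normal)
  let ?r = "sqrt (\<Sum>b\<in>Basis - {e}. (v \<bullet> b)\<^sup>2)"
  let ?W = "\<lambda>w. (\<Sum>b\<in>Basis - {e}. (v \<bullet> b) * (w \<bullet> b), w \<bullet> e)"
  have "(v \<bullet> e) * (w \<bullet> e) + (\<Sum>b\<in>Basis - {e}. (v \<bullet> b) * (w \<bullet> b)) = v \<bullet> w" for w
    by (subst euclidean_inner[of v w], rule sum.remove[symmetric]) (use e in auto)
  then have "(\<integral>\<^sup>+w. F (w \<bullet> e, v \<bullet> w) \<partial>std_gaussian) =
     (\<integral>\<^sup>+w. (\<lambda>(g, m). F (m, (v \<bullet> e) * m + g)) (?W w) \<partial>std_gaussian)"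
    by simp
  also have "\<dots> = (\<integral>\<^sup>+p. (\<lambda>(g, m). F (m, (v \<bullet> e) * m + g)) p \<partial>distr std_gaussian (borel \<Otimes>\<^sub>M borel) ?W)"
    by (rule nn_integral_distr[symmetric]) measurable
  also have "\<dots> = (\<integral>\<^sup>+g. \<integral>\<^sup>+m. F (m, (v \<bullet> e) * m + g) \<partial>std_normal_distribution
      \<partial>distr std_normal_distribution borel ((*) ?r))"
    unfolding distr_std_gaussian_sum_coordinate[OF e]
    by (subst N.nn_integral_fst[symmetric]) (simp_all cong: measurable_cong_sets)
  also have "\<dots> = (\<integral>\<^sup>+h. \<integral>\<^sup>+m. F (m, (v \<bullet> e) * m + ?r * h) \<partial>std_normal_distribution \<partial>std_normal_distribution)"
    by (rule nn_integral_distr) measurable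
  finally show ?thesis .
qed

text \<open>Integrating over \<open>w\<close> first leaves a function of \<open>v\<close> that
  depends only on \<open>v \<bullet> e\<close> and the norm of the remaining part. These become the
  independent variables \<open>n\<close> and \<open>z\<close>.\<close>

lemma nn_integral_pair_std_gaussian:
  fixes e :: "'a::euclidean_space" and F :: "real \<times> real \<Rightarrow> ennreal" and x y :: real
  assumes e: "e \<in> Basis" and F[measurable]: "F \<in> borel_measurable (borel \<Otimes>\<^sub>M borel)"
  shows "(\<integral>\<^sup>+p. F (case p of (v, w) \<Rightarrow> (x * (w \<bullet> e) + y * (v \<bullet> e), v \<bullet> w)) \<partial>(std_gaussian \<Otimes>\<^sub>M std_gaussian)) =
    (\<integral>\<^sup>+z. \<integral>\<^sup>+n. \<integral>\<^sup>+h. \<integral>\<^sup>+m. F (x * m + y * n, n * m + z * h)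
      \<partial>std_normal_distribution \<partial>std_normal_distribution \<partial>std_normal_distribution
      \<partial>chi_distribution (DIM('a) - 1))"
proof -
  interpret N: prob_space std_normal_distribution by (rule prob_space_std_normal)
  interpret G: prob_space "std_gaussian :: 'a measure" by (rule prob_space_std_gaussian)
  let ?R = "\<lambda>v. (sqrt (\<Sum>b\<in>Basis - {e}. (v \<bullet> b)\<^sup>2), v \<bullet> e)"
  define H where "H = (\<lambda>(z, n). \<integral>\<^sup>+h. \<integral>\<^sup>+m. F (x * m + y * n, n * m + z * h)
      \<partial>std_normal_distribution \<partial>std_normal_distribution)"
  have [measurable]: "H \<in> borel_measurable (borel \<Otimes>\<^sub>M borel)"
    unfolding H_def by measurable
  have "(\<integral>\<^sup>+p. F (case p of (v, w) \<Rightarrow> (x * (w \<bullet> e) + y * (v \<bullet> e), v \<bullet> w)) \<partial>(std_gaussian \<Otimes>\<^sub>M std_gaussian)) =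
     (\<integral>\<^sup>+v. \<integral>\<^sup>+w. F (x * (w \<bullet> e) + y * (v \<bullet> e), v \<bullet> w) \<partial>std_gaussian \<partial>std_gaussian)"
    by (subst G.nn_integral_fst[symmetric]) simp_all
  also have "\<dots> = (\<integral>\<^sup>+v. H (?R v) \<partial>std_gaussian)"
  proof (rule nn_integral_cong)
    fix v
    \<comment> \<open>For fixed \<open>v\<close> the term \<open>y * (v \<bullet> e)\<close> is a
      constant and can be absorbed into the integrand.\<close>
    have "(\<lambda>(m, t). F (x * m + y * (v \<bullet> e), t)) \<in> borel_measurable (borel \<Otimes>\<^sub>M borel)"
      by measurable
    from nn_integral_inner_std_gaussian[OF e this, of v]
    show "(\<integral>\<^sup>+w. F (x * (w \<bullet> e) + y * (v \<bullet> e), v \<bullet> w) \<partial>std_gaussian) = H (?R v)"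
      by (simp add: H_def)
  qed
  also have "\<dots> = (\<integral>\<^sup>+p. H p \<partial>distr std_gaussian (borel \<Otimes>\<^sub>M borel) ?R)"
    by (rule nn_integral_distr[symmetric]) measurable
  also have "\<dots> = (\<integral>\<^sup>+z. \<integral>\<^sup>+n. H (z, n) \<partial>std_normal_distribution \<partial>chi_distribution (DIM('a) - 1))"
    unfolding distr_std_gaussian_norm_coordinate[OF e]
    by (rule N.nn_integral_fst[symmetric]) measurable
  finally show ?thesis by (simp add: H_def)
qed

section \<open>Independence as a product of laws\<close>

text \<open>Preimages of measurable sets lie in the generated sigma-algebras, so the two measures
  agree on rectangles, and these determine the product measure.\<close>

lemma indep_rv_distr:
  assumes "prob_space P" and ind: "indep_rv P S X T Y"
  shows "distr P (S \<Otimes>\<^sub>M T) (\<lambda>\<omega>. (X \<omega>, Y \<omega>)) = distr P S X \<Otimes>\<^sub>M distr P T Y"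
proof (rule pair_measure_eqI[symmetric])
  interpret prob_space P by fact
  have X[measurable]: "X \<in> P \<rightarrow>\<^sub>M S" and Y[measurable]: "Y \<in> P \<rightarrow>\<^sub>M T"
    and iset: "indep_set (sets (vimage_algebra (space P) X S)) (sets (vimage_algebra (space P) Y T))"
    using ind by (auto simp: indep_rv_def)
  interpret X: prob_space "distr P S X" by (rule prob_space_distr) fact
  interpret Y: prob_space "distr P T Y" by (rule prob_space_distr) fact
  show "sigma_finite_measure (distr P S X)" "sigma_finite_measure (distr P T Y)" ..
  show "sets (distr P S X \<Otimes>\<^sub>M distr P T Y) = sets (distr P (S \<Otimes>\<^sub>M T) (\<lambda>\<omega>. (X \<omega>, Y \<omega>)))"
    by (simp cong: sets_pair_measure_cong)
  fix A B assume "A \<in> sets (distr P S X)" "B \<in> sets (distr P T Y)"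
  then have [measurable]: "A \<in> sets S" "B \<in> sets T" by simp_all
  have "prob ((X -` A \<inter> space P) \<inter> (Y -` B \<inter> space P)) = prob (X -` A \<inter> space P) * prob (Y -` B \<inter> space P)"
    by (rule indep_setD[OF iset]) (auto intro!: in_vimage_algebra)
  moreover have "(\<lambda>\<omega>. (X \<omega>, Y \<omega>)) -` (A \<times> B) \<inter> space P = (X -` A \<inter> space P) \<inter> (Y -` B \<inter> space P)"
    by auto
  ultimately show "emeasure (distr P S X) A * emeasure (distr P T Y) B =
      emeasure (distr P (S \<Otimes>\<^sub>M T) (\<lambda>\<omega>. (X \<omega>, Y \<omega>))) (A \<times> B)"
    by (simp add: emeasure_distr emeasure_eq_measure ennreal_mult[symmetric])
qed

text \<open>Index 1 is first separated from index 2, then index 0 from both; this yields the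
  right-nested product.\<close>

lemma (in prob_space) distr_triple_indep_vars:
  fixes U V W :: "'a \<Rightarrow> 'b"
  assumes ind: "indep_vars (\<lambda>_. S) (\<lambda>i. [U, V, W] ! i) {..<3}"
  shows "distr M (S \<Otimes>\<^sub>M (S \<Otimes>\<^sub>M S)) (\<lambda>\<omega>. (U \<omega>, V \<omega>, W \<omega>)) =
    distr M S U \<Otimes>\<^sub>M (distr M S V \<Otimes>\<^sub>M distr M S W)"
proof -
  have "distr M (S \<Otimes>\<^sub>M S) (\<lambda>\<omega>. (V \<omega>, W \<omega>)) = distr M S V \<Otimes>\<^sub>M distr M S W"
    using distr_pair_restrict_indep_vars[OF ind, of "{1}" "{2}" "\<lambda>g. g 1" S "\<lambda>g. g 2" S]
    by simp
  moreover have "distr M (S \<Otimes>\<^sub>M (S \<Otimes>\<^sub>M S)) (\<lambda>\<omega>. (U \<omega>, V \<omega>, W \<omega>)) =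
     distr M S U \<Otimes>\<^sub>M distr M (S \<Otimes>\<^sub>M S) (\<lambda>\<omega>. (V \<omega>, W \<omega>))"
    using distr_pair_restrict_indep_vars[OF ind, of "{0}" "{1, 2}" "\<lambda>g. g 0" S "\<lambda>g. (g 1, g 2)" "S \<Otimes>\<^sub>M S"]
    by simp
  ultimately show ?thesis by simp
qed

section \<open>The bilinear form and the identity of the two laws\<close>

lemma bilinear_dot_complex_vec_add:
  fixes a b v w :: "real ^ 'n"
  assumes s: "s\<^sup>2 = complex_of_real p"
  shows "bilinear_dot (complex_vec a + s *s complex_vec v) (complex_vec b + s *s complex_vec w) =
    complex_of_real (a \<bullet> b) + s * complex_of_real (a \<bullet> w + b \<bullet> v) + complex_of_real p * complex_of_real (v \<bullet> w)"
  unfolding s[symmetric]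
  by (simp add: bilinear_dot_def complex_vec_def inner_vec_def sum.distrib[symmetric] sum_distrib_left
      algebra_simps power2_eq_square)

theorem theorem1p1:
  fixes P :: "'a measure" and Q :: "'b measure"
    and xv yv :: "real ^ 'n" and p x y :: real and s :: complex
    and Nv Mv :: "'a \<Rightarrow> real ^ 'n"
    and N N1 M1 Z :: "'b \<Rightarrow> real"
  assumes "prob_space P" and "prob_space Q"
    and sqrt_p: "s\<^sup>2 = complex_of_real p"
    and Nv: "distributed P lborel Nv (\<lambda>v. ennreal (gaussian_vec_density v))"
    and Mv: "distributed P lborel Mv (\<lambda>v. ennreal (gaussian_vec_density v))"
    and indep_vec: "prob_space.indep_var P borel Nv borel Mv"
    and x: "x = (norm (xv + yv) + norm (xv - yv)) / 2"
    and y: "y = (norm (xv + yv) - norm (xv - yv)) / 2"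
    and N: "distributed Q lborel N (\<lambda>t. ennreal (std_normal_density t))"
    and N1: "distributed Q lborel N1 (\<lambda>t. ennreal (std_normal_density t))"
    and M1: "distributed Q lborel M1 (\<lambda>t. ennreal (std_normal_density t))"
    and indep_gauss: "prob_space.indep_vars Q (\<lambda>_. borel) (\<lambda>i. [N, N1, M1] ! i) {..<3}"
    and Z_meas: "Z \<in> borel_measurable Q"
    and Z: "distr Q borel Z = chi_distribution (CARD('n) - 1)"
    and indep_Z: "indep_rv Q borel Z borel (\<lambda>\<omega>. (N \<omega>, N1 \<omega>, M1 \<omega>))"
  shows "distr P borel
           (\<lambda>\<omega>. bilinear_dot (complex_vec xv + s *s complex_vec (Nv \<omega>))
                              (complex_vec yv + s *s complex_vec (Mv \<omega>))) =
         distr Q borel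
           (\<lambda>\<omega>. (complex_of_real x + s * complex_of_real (N1 \<omega>)) *
                 (complex_of_real y + s * complex_of_real (M1 \<omega>)) +
                 complex_of_real p * complex_of_real (Z \<omega> * N \<omega>))"
proof (rule measure_eqI)
  interpret P: prob_space P by fact
  interpret Q: prob_space Q by fact
  interpret S: prob_space std_normal_distribution by (rule prob_space_std_normal)
  interpret SS: pair_sigma_finite std_normal_distribution std_normal_distribution ..
  interpret S2: pair_sigma_finite std_normal_distribution "std_normal_distribution \<Otimes>\<^sub>M std_normal_distribution"
    by unfold_locales
  have [measurable]: "Nv \<in> borel_measurable P" "Mv \<in> borel_measurable P"
    "N \<in> borel_measurable Q" "N1 \<in> borel_measurable Q" "M1 \<in> borel_measurable Q" "Z \<in> borel_measurable Q"
    using Nv Mv N N1 M1 Z_meas by (auto simp: distributed_def)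
  let ?k = "axis (SOME i. True) 1 :: real ^ 'n"
  \<comment> \<open>\<open>?J\<close> rebuilds the complex bilinear form from the real linear term
    and the real inner product. Pulling \<open>A\<close> back along it leaves a comparison of laws
    of real pairs, whatever the sign of \<open>p\<close>.\<close>
  let ?J = "\<lambda>(a, b). complex_of_real (xv \<bullet> yv) + s * complex_of_real a + complex_of_real p * complex_of_real b"
  let ?G = "std_gaussian :: (real ^ 'n) measure" and ?S = std_normal_distribution
  fix A assume "A \<in> sets (distr P borel
           (\<lambda>\<omega>. bilinear_dot (complex_vec xv + s *s complex_vec (Nv \<omega>))
                              (complex_vec yv + s *s complex_vec (Mv \<omega>))))"
  then have [measurable]: "A \<in> sets borel" by simp
  define F where "F q = (indicator A (?J q) :: ennreal)" for q
  have F[measurable]: "F \<in> borel_measurable (borel \<Otimes>\<^sub>M borel)"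
    unfolding F_def by measurable
  have k: "?k \<in> Basis" by (simp add: axis_in_Basis_iff)
  \<comment> \<open>Polarisation: the constant terms of the two sides agree.\<close>
  have "x * y = ((norm (xv + yv))\<^sup>2 - (norm (xv - yv))\<^sup>2) / 4"
    by (simp add: x y field_simps power2_eq_square)
  then have xy: "x * y = xv \<bullet> yv"
    unfolding power2_norm_eq_inner by (simp add: inner_simps inner_commute)
  \<comment> \<open>The dimension of \<open>real ^ 'n\<close> is \<open>CARD('n)\<close>, so the two
    normalising constants coincide.\<close>
  have "distr P borel Nv = ?G" "distr P borel Mv = ?G"
    using distributed_distr_eq_density[OF Nv] distributed_distr_eq_density[OF Mv]
    by (simp_all add: std_gaussian_def gaussian_vec_density_def cong: distr_cong)
  then have NM: "distr P (borel \<Otimes>\<^sub>M borel) (\<lambda>\<omega>. (Nv \<omega>, Mv \<omega>)) = ?G \<Otimes>\<^sub>M ?G"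
    using indep_vec by (simp add: P.indep_var_distribution_eq)
  have "emeasure (distr P borel (\<lambda>\<omega>. bilinear_dot (complex_vec xv + s *s complex_vec (Nv \<omega>))
        (complex_vec yv + s *s complex_vec (Mv \<omega>)))) A =
      (\<integral>\<^sup>+\<omega>. F (case (Nv \<omega>, Mv \<omega>) of (v, w) \<Rightarrow> (xv \<bullet> w + yv \<bullet> v, v \<bullet> w)) \<partial>P)"
    unfolding F_def bilinear_dot_complex_vec_add[OF sqrt_p]
    by (subst emeasure_distr_nn_integral) simp_all
  also have "\<dots> = (\<integral>\<^sup>+q. F (case q of (v, w) \<Rightarrow> (xv \<bullet> w + yv \<bullet> v, v \<bullet> w)) \<partial>(?G \<Otimes>\<^sub>M ?G))"
    unfolding NM[symmetric] by (rule nn_integral_distr[symmetric]) measurable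
  also have "\<dots> = (\<integral>\<^sup>+q. F q \<partial>distr (?G \<Otimes>\<^sub>M ?G) borel (\<lambda>(v, w). (xv \<bullet> w + yv \<bullet> v, v \<bullet> w)))"
    unfolding borel_prod[symmetric] by (rule nn_integral_distr[symmetric]) measurable
  also have "\<dots> = (\<integral>\<^sup>+q. F q \<partial>distr (?G \<Otimes>\<^sub>M ?G) borel (\<lambda>(v, w). (x * (w \<bullet> ?k) + y * (v \<bullet> ?k), v \<bullet> w)))"
    by (subst distr_std_gaussian_inner_rotate[OF _ x y, of ?k]) simp_all
  also have "\<dots> = (\<integral>\<^sup>+q. F (case q of (v, w) \<Rightarrow> (x * (w \<bullet> ?k) + y * (v \<bullet> ?k), v \<bullet> w)) \<partial>(?G \<Otimes>\<^sub>M ?G))"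
    unfolding borel_prod[symmetric] by (rule nn_integral_distr) measurable
  also have "\<dots> = (\<integral>\<^sup>+z. \<integral>\<^sup>+n. \<integral>\<^sup>+h. \<integral>\<^sup>+m. F (x * m + y * n, n * m + z * h) \<partial>?S \<partial>?S \<partial>?S
      \<partial>chi_distribution (CARD('n) - 1))"
    using nn_integral_pair_std_gaussian[OF k F] by simp
  \<comment> \<open>The two normal integrals are exchanged so that the order
    \<open>z, h, n, m\<close> matches the tuple \<open>(Z, N, N1, M1)\<close>.\<close>
  also have "\<dots> = (\<integral>\<^sup>+z. \<integral>\<^sup>+h. \<integral>\<^sup>+n. \<integral>\<^sup>+m. F (x * m + y * n, n * m + z * h) \<partial>?S \<partial>?S \<partial>?S
      \<partial>chi_distribution (CARD('n) - 1))"
    by (intro nn_integral_cong SS.Fubini') measurable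
  also have "\<dots> = (\<integral>\<^sup>+q. (\<lambda>(z, h, n, m). F (x * m + y * n, n * m + z * h)) q
      \<partial>(chi_distribution (CARD('n) - 1) \<Otimes>\<^sub>M (?S \<Otimes>\<^sub>M (?S \<Otimes>\<^sub>M ?S))))"
    by (simp add: S.nn_integral_fst[symmetric] SS.nn_integral_fst[symmetric] S2.nn_integral_fst[symmetric])
  also have "chi_distribution (CARD('n) - 1) \<Otimes>\<^sub>M (?S \<Otimes>\<^sub>M (?S \<Otimes>\<^sub>M ?S)) =
      distr Q (borel \<Otimes>\<^sub>M (borel \<Otimes>\<^sub>M (borel \<Otimes>\<^sub>M borel))) (\<lambda>\<omega>. (Z \<omega>, N \<omega>, N1 \<omega>, M1 \<omega>))"
  proof -
    have "distr Q borel N = ?S" "distr Q borel N1 = ?S" "distr Q borel M1 = ?S"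
      using N N1 M1 by (auto dest!: distributed_distr_eq_density cong: distr_cong)
    then show ?thesis
      using indep_rv_distr[OF \<open>prob_space Q\<close> indep_Z] Q.distr_triple_indep_vars[OF indep_gauss] Z
      by (simp add: borel_prod)
  qed
  also have "(\<integral>\<^sup>+q. (\<lambda>(z, h, n, m). F (x * m + y * n, n * m + z * h)) q
      \<partial>distr Q (borel \<Otimes>\<^sub>M (borel \<Otimes>\<^sub>M (borel \<Otimes>\<^sub>M borel))) (\<lambda>\<omega>. (Z \<omega>, N \<omega>, N1 \<omega>, M1 \<omega>))) =
      (\<integral>\<^sup>+\<omega>. F (x * M1 \<omega> + y * N1 \<omega>, N1 \<omega> * M1 \<omega> + Z \<omega> * N \<omega>) \<partial>Q)"
    by (subst nn_integral_distr) simp_all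
  \<comment> \<open>Expanding the product gives \<open>x * y\<close>, the cross terms
    \<open>s * (x * M1 + y * N1)\<close>, and \<open>N1 * M1\<close> with factor
    \<open>s^2 = p\<close>, which is exactly the value of \<open>?J\<close>.\<close>
  also have "\<dots> = (\<integral>\<^sup>+\<omega>. indicator A ((complex_of_real x + s * complex_of_real (N1 \<omega>)) *
                 (complex_of_real y + s * complex_of_real (M1 \<omega>)) +
                 complex_of_real p * complex_of_real (Z \<omega> * N \<omega>)) \<partial>Q)"
    unfolding F_def sqrt_p[symmetric] xy[symmetric]
    by (simp add: algebra_simps power2_eq_square)
  also have "\<dots> = emeasure (distr Q borel
           (\<lambda>\<omega>. (complex_of_real x + s * complex_of_real (N1 \<omega>)) *
                 (complex_of_real y + s * complex_of_real (M1 \<omega>)) +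
                 complex_of_real p * complex_of_real (Z \<omega> * N \<omega>))) A"
    by (subst emeasure_distr_nn_integral) simp_all
  finally show "emeasure (distr P borel
           (\<lambda>\<omega>. bilinear_dot (complex_vec xv + s *s complex_vec (Nv \<omega>))
                              (complex_vec yv + s *s complex_vec (Mv \<omega>)))) A =
      emeasure (distr Q borel
           (\<lambda>\<omega>. (complex_of_real x + s * complex_of_real (N1 \<omega>)) *
                 (complex_of_real y + s * complex_of_real (M1 \<omega>)) +
                 complex_of_real p * complex_of_real (Z \<omega> * N \<omega>))) A" .
qed simp

end
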